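(* Let $u_0 \in L^2(\mathbb{R})$ and let $u=u(x,t)$ be the global in time solution of the initial value problem $$\partial_t u - \mathcal{H}\partial_x^2 u + u\,\partial_x u = 0,\quad x,t\in\mathbb{R},\qquad u(x,0)=u_0(x),$$ with $u \in C(\mathbb{R}:L^2(\mathbb{R}))\cap L^{\infty}(\mathbb{R}:L^2(\mathbb{R}))$. Let $0<b<\tfrac{2}{3}$ and $B_{t^b}(0)=\{x\in\mathbb{R}: |x|<t^b\}$. Then $$\liminf_{t\to\infty}\int_{B_{t^b}(0)} u^2(x,t)\,dx = 0.$$ Moreover, there exist a constant $C>0$ and an increasing sequence of times $t_n\to\infty$ such that $$\int_{B_{t_n^b}(0)} u^2(x,t_n)\,dx \le \frac{C}{\log^{\frac{1-b}{b}}(t_n)}.$$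
   Context: $\mathcal{H}$ denotes the Hilbert transform on the line, $\mathcal{H}f(x)=\mathrm{p.v.}\frac{1}{\pi}\int_{\mathbb{R}}\frac{f(y)}{x-y}\,dy$. The equation is the Benjamin–Ono equation; $u$ is real-valued. *)

theory Defs
  imports "HOL-Analysis.Analysis"
begin

definition L2 :: "(real \<Rightarrow> real) \<Rightarrow> bool" where
  "L2 f \<longleftrightarrow> f \<in> borel_measurable lborel \<and> integrable lborel (\<lambda>x. (f x)\<^sup>2)"

definition test_fun :: "(real \<Rightarrow> real) \<Rightarrow> bool" where
  "test_fun \<phi> \<longleftrightarrow> (\<forall>k x. ((deriv ^^ k) \<phi>) differentiable (at x))
                   \<and> (\<exists>R. \<forall>x. R < \<bar>x\<bar> \<longrightarrow> \<phi> x = 0)"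

definition hilbert :: "(real \<Rightarrow> real) \<Rightarrow> real \<Rightarrow> real" where
  "hilbert f x = Lim (at_right 0)
     (\<lambda>\<epsilon>. (1 / pi) * (LINT y:{y. \<epsilon> < \<bar>x - y\<bar>}|lborel. f y / (x - y)))"

definition C_L2 :: "(real \<Rightarrow> real \<Rightarrow> real) \<Rightarrow> bool" where
  "C_L2 u \<longleftrightarrow> (\<forall>t. L2 (\<lambda>x. u x t)) \<and>
     (\<forall>t. ((\<lambda>s. LINT x|lborel. (u x s - u x t)\<^sup>2) \<longlongrightarrow> 0) (at t))"

definition Linf_L2 :: "(real \<Rightarrow> real \<Rightarrow> real) \<Rightarrow> bool" where
  "Linf_L2 u \<longleftrightarrow> (\<exists>M. \<forall>t. (LINT x|lborel. (u x t)\<^sup>2) \<le> M)"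

text \<open>Weak (integral-in-time, distributional-in-space) solution of
  u_t - H u_xx + u u_x = 0, u(.,0) = u0: for every test function phi and every t,
  int u(x,t) phi(x) dx = int u0 phi dx
     + int_0^t int ( - u(x,s) (H phi'')(x) + u(x,s)^2/2 phi'(x) ) dx ds.\<close>
definition BO_solution :: "(real \<Rightarrow> real) \<Rightarrow> (real \<Rightarrow> real \<Rightarrow> real) \<Rightarrow> bool" where
  "BO_solution u0 u \<longleftrightarrow>
     C_L2 u \<and> Linf_L2 u \<and> (AE x in lborel. u x 0 = u0 x) \<and>
     (\<forall>\<phi> t. test_fun \<phi> \<longrightarrow>
        (LINT x|lborel. u x t * \<phi> x) =
        (LINT x|lborel. u0 x * \<phi> x) +
        (LBINT s=0..t. (LINT x|lborel.
            - u x s * hilbert (deriv (deriv \<phi>)) x + (u x s)\<^sup>2 / 2 * deriv \<phi> x)))"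

end

theory Submission
  imports Defs "HOL-Computational_Algebra.Polynomial" "HOL-Probability.Sinc_Integral"
    "HOL-Real_Asymp.Real_Asymp"
begin

text \<open>
  Test the equation on a dyadic time interval $[T, 2T]$ against the fixed function
  $\phi(x) = R\,(G(x/R) - G(x/L))$, where $G' = g$ is a nonnegative bump, $R \sim T^b$ and
  $L = T^{1-b/2}$. The pairing $\int u\phi$ has the flux of the equation as its time derivative, so by
  the mean value theorem the flux is at most of order $R L^{1/2}/T$ at some time in $[T, 2T]$
  (Cauchy-Schwarz at both endpoints). Near the origin $\phi' \ge c > 0$ up to an error $R/L$, which is
  also the size of the negative part of $\phi'$; hence at that time the local mass is bounded by a
  constant times $R L^{1/2}/T$ $+\ R/L$ $+\ R^{-1/2}$, the last being the dispersive term, since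
  $\mathcal{H}\phi''$ consists of dilates of $\mathcal{H}g' \in L^2$. For $b < 2/3$ this is a negative
  power of $T$, which beats every power of the logarithm.
\<close>

section \<open>Preliminaries on derivatives and limits\<close>

lemma funpow_deriv_differentiable:
  fixes f :: "'a::real_normed_field \<Rightarrow> 'a"
  assumes "f \<in> S" and "\<And>g. g \<in> S \<Longrightarrow> \<exists>g'\<in>S. \<forall>x. (g has_field_derivative g' x) (at x)"
  shows "((deriv ^^ k) f) differentiable (at x)"
proof -
  have deriv_in: "deriv g \<in> S" if "g \<in> S" for g
  proof -
    obtain g' where "g' \<in> S" "\<forall>x. (g has_field_derivative g' x) (at x)"
      using assms(2)[OF \<open>g \<in> S\<close>] by blast
    moreover from this have "deriv g = g'"
      by (intro ext DERIV_imp_deriv) blast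
    ultimately show ?thesis by simp
  qed
  have "(deriv ^^ k) f \<in> S"
    by (induction k) (use assms(1) deriv_in in auto)
  then show ?thesis
    using assms(2) field_differentiable_def field_differentiable_imp_differentiable by blast
qed

lemma DERIV_dilation:
  assumes "\<And>x. (f has_real_derivative f' x) (at x)"
  shows "((\<lambda>x. f (x / R)) has_real_derivative f' (x / R) / R) (at x)"
  using DERIV_chain2[OF assms DERIV_cdivide[OF DERIV_ident]] by simp

lemma DERIV_interval_integral:
  fixes f :: "real \<Rightarrow> real" and c :: real
  assumes "continuous_on UNIV f"
  shows "((\<lambda>x. LBINT y=c..x. f y) has_real_derivative f x) (at x)"
proof -
  define a b where "a = min c x - 1" and "b = max c x + 1"
  have "((\<lambda>x. LBINT y=c..x. f y) has_vector_derivative f x) (at x within {a..b})"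
    by (rule interval_integral_FTC2)
      (auto simp: a_def b_def intro: continuous_on_subset[OF assms])
  moreover have "at x within {a..b} = at x"
    by (rule at_within_interior) (auto simp: a_def b_def)
  ultimately show ?thesis
    by (simp add: has_real_derivative_iff_has_vector_derivative)
qed

lemma frequently_at_topI:
  fixes P :: "'a::linorder \<Rightarrow> bool"
  assumes "\<forall>\<^sub>F t in at_top. \<exists>s\<ge>t. P s"
  shows "\<exists>\<^sub>F t in at_top. P t"
proof (rule ccontr)
  assume "\<not> (\<exists>\<^sub>F t in at_top. P t)"
  then obtain N where "\<And>s. N \<le> s \<Longrightarrow> \<not> P s"
    by (auto simp: not_frequently eventually_at_top_linorder)
  moreover obtain N' where "\<And>t. N' \<le> t \<Longrightarrow> \<exists>s\<ge>t. P s"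
    using assms by (auto simp: eventually_at_top_linorder)
  ultimately show False by (metis max.bounded_iff max.cobounded1 max.cobounded2)
qed

lemma Liminf_eq_0_if_frequently_le:
  fixes f g :: "'a \<Rightarrow> real"
  assumes "\<And>x. 0 \<le> f x" and "\<exists>\<^sub>F x in F. f x \<le> g x" and "(g \<longlongrightarrow> 0) F"
  shows "Liminf F (\<lambda>x. ereal (f x)) = 0"
proof (rule antisym)
  show "Liminf F (\<lambda>x. ereal (f x)) \<le> 0"
  proof (rule ccontr)
    assume "\<not> Liminf F (\<lambda>x. ereal (f x)) \<le> 0"
    then obtain y where y_between: "0 < ereal y" "ereal y < Liminf F (\<lambda>x. ereal (f x))"
      using ereal_dense2[of 0] by (auto simp: not_le)
    have "\<forall>\<^sub>F x in F. y < f x" using less_LiminfD[OF y_between(2)] by simp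
    moreover have "\<forall>\<^sub>F x in F. g x < y" using order_tendstoD(2)[OF assms(3)] y_between(1) by simp
    ultimately have "\<forall>\<^sub>F x in F. \<not> f x \<le> g x" by eventually_elim simp
    then show False using assms(2) by (simp add: frequently_def)
  qed
  show "0 \<le> Liminf F (\<lambda>x. ereal (f x))"
    by (rule Liminf_bounded) (use assms(1) in auto)
qed

lemma frequently_at_top_imp_sequence:
  fixes P :: "real \<Rightarrow> bool"
  assumes "\<exists>\<^sub>F t in at_top. P t"
  obtains \<tau> :: "nat \<Rightarrow> real" where "strict_mono \<tau>" "filterlim \<tau> at_top sequentially" "\<And>n. P (\<tau> n)"
proof -
  have ex_beyond: "\<exists>t>c. P t" for c
    using frequently_eventually_frequently[OF assms eventually_gt_at_top[of c]] frequently_ex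
    by blast
  have "\<exists>\<tau>. \<forall>n. (P (\<tau> n) \<and> real n \<le> \<tau> n) \<and> \<tau> n < \<tau> (Suc n)"
  proof (rule dependent_nat_choice)
    show "\<exists>t. P t \<and> real 0 \<le> t" using ex_beyond[of 0] by auto
    show "\<exists>t'. (P t' \<and> real (Suc n) \<le> t') \<and> t < t'" for n t
      using ex_beyond[of "max t (real (Suc n))"] by auto
  qed
  then obtain \<tau> where \<tau>_props: "\<And>n. P (\<tau> n)" "\<And>n. real n \<le> \<tau> n" "\<And>n. \<tau> n < \<tau> (Suc n)" by blast
  have "filterlim \<tau> at_top sequentially"
    by (rule filterlim_at_top_mono[OF filterlim_real_sequentially]) (use \<tau>_props(2) in simp)
  with \<tau>_props show ?thesis by (intro that) (auto simp: strict_mono_Suc_iff)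
qed

section \<open>Test functions\<close>

lemma test_funI:
  assumes "\<phi> \<in> S" and "\<And>g. g \<in> S \<Longrightarrow> \<exists>g'\<in>S. \<forall>x. (g has_real_derivative g' x) (at x)"
    and "\<And>x. r < \<bar>x\<bar> \<Longrightarrow> \<phi> x = 0"
  shows "test_fun \<phi>"
  unfolding test_fun_def using funpow_deriv_differentiable[OF assms(1,2)] assms(3) by blast

lemma test_fun_support:
  assumes "test_fun \<phi>"
  obtains r where "0 < r" "\<And>x. r \<le> \<bar>x\<bar> \<Longrightarrow> \<phi> x = 0"
proof -
  obtain r where "\<And>x. r < \<bar>x\<bar> \<Longrightarrow> \<phi> x = 0"
    using assms unfolding test_fun_def by blast
  then show ?thesis
    by (intro that[of "\<bar>r\<bar> + 1"]) auto
qed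

lemma test_fun_DERIV:
  assumes "test_fun \<phi>"
  shows "(\<phi> has_real_derivative deriv \<phi> x) (at x)"
proof -
  have "((deriv ^^ 0) \<phi>) differentiable (at x)"
    using assms unfolding test_fun_def by blast
  then show ?thesis
    by (simp add: DERIV_deriv_iff_real_differentiable)
qed

lemma test_fun_deriv:
  assumes "test_fun \<phi>"
  shows "test_fun (deriv \<phi>)"
proof -
  obtain r where outside_r: "\<And>x. r \<le> \<bar>x\<bar> \<Longrightarrow> \<phi> x = 0"
    using test_fun_support[OF assms] by blast
  have "deriv \<phi> x = 0" if "r < \<bar>x\<bar>" for x
  proof (rule DERIV_imp_deriv, rule has_field_derivative_transform_within_open)
    show "((\<lambda>_. 0) has_real_derivative 0) (at x)" by simp
    show "open {y::real. r < \<bar>y\<bar>}" by (intro open_Collect_less continuous_intros)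
  qed (use that outside_r in auto)
  moreover have "((deriv ^^ k) (deriv \<phi>)) differentiable (at x)" for k x
  proof -
    have "((deriv ^^ Suc k) \<phi>) differentiable (at x)"
      using assms unfolding test_fun_def by blast
    then show ?thesis by (simp add: funpow_swap1)
  qed
  ultimately show ?thesis unfolding test_fun_def by blast
qed

lemma test_fun_continuous_on: "test_fun \<phi> \<Longrightarrow> continuous_on A \<phi>"
  by (intro continuous_at_imp_continuous_on ballI DERIV_isCont[OF test_fun_DERIV])

lemma test_fun_measurable: "test_fun \<phi> \<Longrightarrow> \<phi> \<in> borel_measurable borel"
  by (intro borel_measurable_continuous_onI test_fun_continuous_on)

lemma test_fun_bounded:
  assumes "test_fun \<phi>"
  obtains B where "\<And>x. \<bar>\<phi> x\<bar> \<le> B"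
proof -
  obtain r where support_r: "0 < r" "\<And>x. r \<le> \<bar>x\<bar> \<Longrightarrow> \<phi> x = 0"
    using test_fun_support[OF assms] by blast
  have "bounded (\<phi> ` {-r..r})"
    by (intro compact_imp_bounded compact_continuous_image test_fun_continuous_on assms compact_Icc)
  then obtain B where le_B: "\<And>x. x \<in> {-r..r} \<Longrightarrow> \<bar>\<phi> x\<bar> \<le> B"
    unfolding bounded_iff image_iff real_norm_def by blast
  have "0 \<le> B"
    using le_B[of 0] support_r(1) by auto
  then have "\<bar>\<phi> x\<bar> \<le> B" for x
    using le_B[of x] support_r(2)[of x] by (cases "\<bar>x\<bar> \<le> r") (auto simp: abs_le_iff)
  then show ?thesis by (rule that)
qed

lemma test_fun_lipschitz:
  assumes "test_fun \<phi>"
  obtains C where "C-lipschitz_on UNIV \<phi>"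
proof -
  obtain C where deriv_le: "\<And>x. \<bar>deriv \<phi> x\<bar> \<le> C"
    using test_fun_bounded[OF test_fun_deriv[OF assms]] by blast
  have "C-lipschitz_on UNIV \<phi>"
  proof (rule lipschitz_onI)
    show "dist (\<phi> x) (\<phi> y) \<le> C * dist x y" for x y
      using field_differentiable_bound[of UNIV \<phi> "deriv \<phi>" C x y] test_fun_DERIV[OF assms] deriv_le
      by (simp add: dist_real_def)
    show "0 \<le> C" using deriv_le[of 0] by simp
  qed
  then show ?thesis by (rule that)
qed

lemma test_fun_scale:
  assumes "test_fun \<phi>" "0 < R"
  shows "test_fun (\<lambda>x. a * \<phi> (x / R))"
proof -
  obtain r where outside_r: "\<And>x. r \<le> \<bar>x\<bar> \<Longrightarrow> \<phi> x = 0"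
    using test_fun_support[OF assms(1)] by blast
  let ?S = "{\<lambda>x. d * \<psi> (x / R) | d \<psi>. test_fun \<psi>}"
  show ?thesis
  proof (rule test_funI[where S = ?S and r = "r * R"])
    show "\<exists>g'\<in>?S. \<forall>x. (g has_real_derivative g' x) (at x)" if "g \<in> ?S" for g
    proof -
      obtain d \<psi> where "g = (\<lambda>x. d * \<psi> (x / R))" and "test_fun \<psi>"
        using \<open>g \<in> ?S\<close> by blast
      then have "\<forall>x. (g has_real_derivative (d / R) * deriv \<psi> (x / R)) (at x)"
        using DERIV_cmult[OF DERIV_dilation[OF test_fun_DERIV[of \<psi>]], of d] by simp
      moreover have "(\<lambda>x. (d / R) * deriv \<psi> (x / R)) \<in> ?S"
        using test_fun_deriv[OF \<open>test_fun \<psi>\<close>] by blast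
      ultimately show ?thesis by (rule bexI)
    qed
    show "a * \<phi> (x / R) = 0" if "r * R < \<bar>x\<bar>" for x
      using that outside_r[of "x / R"] assms(2) by (simp add: field_simps)
  qed (use assms(1) in blast)
qed

lemma test_fun_diff:
  assumes "test_fun \<phi>" "test_fun \<psi>"
  shows "test_fun (\<lambda>x. \<phi> x - \<psi> x)"
proof -
  obtain r s where outside_r: "\<And>x. r \<le> \<bar>x\<bar> \<Longrightarrow> \<phi> x = 0" and outside_s: "\<And>x. s \<le> \<bar>x\<bar> \<Longrightarrow> \<psi> x = 0"
    using test_fun_support[OF assms(1)] test_fun_support[OF assms(2)] by metis
  let ?S = "{\<lambda>x. f x - g x | f g. test_fun f \<and> test_fun g}"
  show ?thesis
  proof (rule test_funI[where S = ?S and r = "max r s"])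
    show "\<exists>h'\<in>?S. \<forall>x. (h has_real_derivative h' x) (at x)" if "h \<in> ?S" for h
    proof -
      obtain f g where "h = (\<lambda>x. f x - g x)" and "test_fun f" "test_fun g"
        using \<open>h \<in> ?S\<close> by blast
      then have "\<forall>x. (h has_real_derivative deriv f x - deriv g x) (at x)"
        by (auto intro: DERIV_diff test_fun_DERIV)
      moreover have "(\<lambda>x. deriv f x - deriv g x) \<in> ?S"
        using \<open>test_fun f\<close> \<open>test_fun g\<close> test_fun_deriv by blast
      ultimately show ?thesis by (rule bexI)
    qed
  qed (use assms outside_r outside_s in auto)
qed

lemma test_fun_antiderivative:
  assumes "\<And>x. (\<phi> has_real_derivative \<psi> x) (at x)" and "test_fun \<psi>" and "\<And>x. r < \<bar>x\<bar> \<Longrightarrow> \<phi> x = 0"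
  shows "test_fun \<phi>"
proof (rule test_funI[where S = "insert \<phi> (Collect test_fun)"])
  show "\<exists>g'\<in>insert \<phi> (Collect test_fun). \<forall>x. (g has_real_derivative g' x) (at x)"
    if "g \<in> insert \<phi> (Collect test_fun)" for g
    using that assms(1,2) test_fun_DERIV test_fun_deriv by blast
qed (use assms(3) in auto)

section \<open>A smooth bump\<close>

definition flat_exp :: "nat \<Rightarrow> real \<Rightarrow> real" where
  "flat_exp n w = (if 0 < w then exp (- 1 / w) / w ^ n else 0)"

lemma flat_exp_eq_mult_Suc: "flat_exp n w = w * flat_exp (Suc n) w"
  by (simp add: flat_exp_def)

lemma DERIV_flat_exp_0: "(flat_exp n has_real_derivative 0) (at 0)"
proof -
  have "((\<lambda>w. inverse w ^ Suc n / exp (inverse w)) \<longlongrightarrow> (0::real)) (at_right 0)"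
    by (rule filterlim_compose[OF tendsto_power_div_exp_0 filterlim_inverse_at_top_right])
  moreover have "\<forall>\<^sub>F w in at_right 0. inverse w ^ Suc n / exp (inverse w) = flat_exp n w / w"
    using eventually_at_right_less[of "0::real"]
    by eventually_elim (simp add: flat_exp_def exp_minus field_simps)
  ultimately have "((\<lambda>w. flat_exp n w / w) \<longlongrightarrow> 0) (at_right 0)"
    by (rule Lim_transform_eventually)
  moreover have "\<forall>\<^sub>F w in at_left 0. 0 = flat_exp n w / w"
    unfolding eventually_at_filter by (auto simp: flat_exp_def)
  then have "((\<lambda>w. flat_exp n w / w) \<longlongrightarrow> 0) (at_left 0)"
    by (rule Lim_transform_eventually[OF tendsto_const])
  ultimately have "((\<lambda>w. flat_exp n w / w) \<longlongrightarrow> 0) (at 0)"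
    by (simp add: filterlim_at_split)
  then show ?thesis
    by (simp add: has_field_derivative_iff flat_exp_def)
qed

lemma DERIV_flat_exp:
  "(flat_exp n has_real_derivative flat_exp (n + 2) w - real n * flat_exp (n + 1) w) (at w)"
proof -
  consider (pos) "0 < w" | (zero) "w = 0" | (neg) "w < 0" by linarith
  then show ?thesis
  proof cases
    case pos
    have "real n * w ^ (n - 1) = real n * w ^ n / w"
      using pos by (cases n) auto
    then have "((\<lambda>w. exp (- 1 / w) / w ^ n) has_real_derivative
        exp (- 1 / w) / w ^ (n + 2) - real n * (exp (- 1 / w) / w ^ (n + 1))) (at w)"
      using pos by (auto intro!: derivative_eq_intros simp: field_simps power2_eq_square)
    then have "((\<lambda>w. exp (- 1 / w) / w ^ n) has_real_derivative
        flat_exp (n + 2) w - real n * flat_exp (n + 1) w) (at w)"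
      using pos by (simp add: flat_exp_def)
    then show ?thesis
      by (rule has_field_derivative_transform_within_open[where S = "{0<..}"])
        (use pos in \<open>auto simp: flat_exp_def\<close>)
  next
    case zero
    then show ?thesis using DERIV_flat_exp_0[of n] by (simp add: flat_exp_def)
  next
    case neg
    have "((\<lambda>_. 0) has_real_derivative flat_exp (n + 2) w - real n * flat_exp (n + 1) w) (at w)"
      using neg by (simp add: flat_exp_def)
    then show ?thesis
      by (rule has_field_derivative_transform_within_open[where S = "{..<0}"])
        (use neg in \<open>auto simp: flat_exp_def\<close>)
  qed
qed

definition bump :: "real \<Rightarrow> real" where
  "bump x = flat_exp 0 (1 - x\<^sup>2)"

lemma bump_eq_0: "1 \<le> \<bar>x\<bar> \<Longrightarrow> bump x = 0"
  using power_mono[of 1 "\<bar>x\<bar>" 2] by (simp add: bump_def flat_exp_def)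

lemma bump_nonneg: "0 \<le> bump x"
  by (simp add: bump_def flat_exp_def)

lemma bump_le_1: "bump x \<le> 1"
  by (simp add: bump_def flat_exp_def)

lemma bump_ge:
  assumes "\<bar>x\<bar> \<le> 1 / 2"
  shows "exp (- 4 / 3) \<le> bump x"
proof -
  have "x\<^sup>2 \<le> (1 / 2)\<^sup>2"
    using power_mono[OF assms, of 2] by simp
  then have "3 / 4 \<le> 1 - x\<^sup>2"
    by (simp add: power2_eq_square)
  moreover from this have "1 / (1 - x\<^sup>2) \<le> 1 / (3 / 4)"
    by (intro divide_left_mono) auto
  ultimately show ?thesis by (simp add: bump_def flat_exp_def)
qed

lemma DERIV_poly_mult_flat_exp:
  obtains q where "\<And>x. ((\<lambda>x. poly p x * flat_exp n (1 - x\<^sup>2)) has_real_derivative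
    poly q x * flat_exp (n + 2) (1 - x\<^sup>2)) (at x)"
proof -
  define w q :: "real poly" where "w = [:1, 0, -1:]"
    and "q = pderiv p * w\<^sup>2 - [:0, 2:] * p * (1 - smult (real n) w)"
  have "((\<lambda>x. poly p x * flat_exp n (1 - x\<^sup>2)) has_real_derivative
      poly q x * flat_exp (n + 2) (1 - x\<^sup>2)) (at x)" for x
  proof -
    have poly_w: "poly w x = 1 - x\<^sup>2" by (simp add: w_def power2_eq_square)
    define F where "F = flat_exp (n + 2) (1 - x\<^sup>2)"
    have flat_eq: "flat_exp (n + 1) (1 - x\<^sup>2) = (1 - x\<^sup>2) * F"
      "flat_exp n (1 - x\<^sup>2) = (1 - x\<^sup>2)\<^sup>2 * F"
      using flat_exp_eq_mult_Suc[of n "1 - x\<^sup>2"] flat_exp_eq_mult_Suc[of "n + 1" "1 - x\<^sup>2"]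
      by (simp_all add: F_def power2_eq_square)
    have "((\<lambda>x. flat_exp n (1 - x\<^sup>2)) has_real_derivative
        (F - real n * ((1 - x\<^sup>2) * F)) * (- 2 * x)) (at x)"
      unfolding F_def flat_eq(1)[symmetric, unfolded F_def]
      by (rule DERIV_chain2[OF DERIV_flat_exp]) (auto intro!: derivative_eq_intros)
    from DERIV_mult[OF poly_DERIV[of p x] this] show ?thesis
      unfolding F_def[symmetric] flat_eq(2)
      by (rule DERIV_cong) (simp add: q_def poly_w algebra_simps)
  qed
  then show ?thesis by (rule that)
qed

lemma test_fun_bump: "test_fun bump"
proof -
  let ?S = "{\<lambda>x. poly p x * flat_exp n (1 - x\<^sup>2) | p n. True}"
  show ?thesis
  proof (rule test_funI[where S = ?S and r = 1])
    have "bump = (\<lambda>x. poly 1 x * flat_exp 0 (1 - x\<^sup>2))"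
      by (simp add: bump_def fun_eq_iff)
    then show "bump \<in> ?S" by blast
    show "\<exists>g'\<in>?S. \<forall>x. (g has_real_derivative g' x) (at x)" if "g \<in> ?S" for g
    proof -
      obtain p n where "g = (\<lambda>x. poly p x * flat_exp n (1 - x\<^sup>2))"
        using \<open>g \<in> ?S\<close> by blast
      then obtain q where
        "\<forall>x. (g has_real_derivative poly q x * flat_exp (n + 2) (1 - x\<^sup>2)) (at x)"
        using DERIV_poly_mult_flat_exp by blast
      moreover have "(\<lambda>x. poly q x * flat_exp (n + 2) (1 - x\<^sup>2)) \<in> ?S" by blast
      ultimately show ?thesis by (rule bexI)
    qed
  qed (simp add: bump_eq_0)
qed

definition bump_primitive :: "real \<Rightarrow> real" where
  "bump_primitive x = (LBINT y=0..x. bump y)"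

lemma DERIV_bump_primitive: "(bump_primitive has_real_derivative bump x) (at x)"
  unfolding bump_primitive_def[abs_def] zero_ereal_def
  by (intro DERIV_interval_integral test_fun_continuous_on test_fun_bump)

lemma bump_primitive_constant:
  assumes "1 \<le> \<bar>x\<bar>"
  shows "bump_primitive x = bump_primitive (sgn x)"
proof -
  have cont: "continuous_on A bump_primitive" for A
    by (intro continuous_at_imp_continuous_on ballI DERIV_isCont[OF DERIV_bump_primitive])
  have deriv_zero: "(bump_primitive has_real_derivative 0) (at y)" if "1 \<le> \<bar>y\<bar>" for y
    using DERIV_bump_primitive[of y] bump_eq_0[OF that] by simp
  consider (endpoint) "x = 1 \<or> x = - 1" | (right) "1 < x" | (left) "x < - 1" using assms by linarith
  then show ?thesis
  proof cases
    case right
    then show ?thesis using DERIV_isconst_end[OF _ cont, of 1 x] deriv_zero by simp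
  next
    case left
    then show ?thesis using DERIV_isconst_end[OF _ cont, of x "-1"] deriv_zero by simp
  qed auto
qed

lemma abs_bump_primitive_le: "\<bar>bump_primitive x\<bar> \<le> 1"
proof -
  have "\<bar>bump_primitive y - bump_primitive 0\<bar> \<le> 1 * \<bar>y - 0\<bar>" for y
    using field_differentiable_bound[of UNIV bump_primitive bump 1 y 0]
      DERIV_bump_primitive bump_nonneg bump_le_1 by simp
  then have abs_le: "\<bar>bump_primitive y\<bar> \<le> \<bar>y\<bar>" for y
    by (simp add: bump_primitive_def zero_ereal_def)
  show ?thesis
  proof (cases "1 \<le> \<bar>x\<bar>")
    case True
    then show ?thesis
      using abs_le[of "sgn x"] bump_primitive_constant[OF True] by (simp add: sgn_if split: if_splits)
  next
    case False
    then show ?thesis using abs_le[of x] by simp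
  qed
qed

section \<open>Square-integrable functions\<close>

lemma integrable_mult_square_integrable:
  fixes f g :: "'a \<Rightarrow> real"
  assumes [measurable]: "f \<in> borel_measurable M" "g \<in> borel_measurable M"
    and "integrable M (\<lambda>x. (f x)\<^sup>2)" "integrable M (\<lambda>x. (g x)\<^sup>2)"
  shows "integrable M (\<lambda>x. f x * g x)"
proof (rule Bochner_Integration.integrable_bound)
  show "integrable M (\<lambda>x. (f x)\<^sup>2 + (g x)\<^sup>2)"
    using assms(3,4) by simp
  have "\<bar>f x * g x\<bar> \<le> (f x)\<^sup>2 + (g x)\<^sup>2" for x
    using sum_squares_bound[of "\<bar>f x\<bar>" "\<bar>g x\<bar>"] abs_ge_zero[of "f x * g x"]
    unfolding abs_mult power2_abs by linarith
  then show "AE x in M. norm (f x * g x) \<le> norm ((f x)\<^sup>2 + (g x)\<^sup>2)" by simp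
qed measurable

lemma Cauchy_Schwarz_integral:
  fixes f g :: "'a \<Rightarrow> real"
  assumes "f \<in> borel_measurable M" "g \<in> borel_measurable M"
    and "integrable M (\<lambda>x. (f x)\<^sup>2)" "integrable M (\<lambda>x. (g x)\<^sup>2)"
  shows "(\<integral>x. f x * g x \<partial>M)\<^sup>2 \<le> (\<integral>x. (f x)\<^sup>2 \<partial>M) * (\<integral>x. (g x)\<^sup>2 \<partial>M)"
proof -
  define A P B where "A = (\<integral>x. (f x)\<^sup>2 \<partial>M)" and "P = (\<integral>x. f x * g x \<partial>M)" and "B = (\<integral>x. (g x)\<^sup>2 \<partial>M)"
  have discr: "0 \<le> A - 2 * r * P + r\<^sup>2 * B" for r
  proof -
    have "0 \<le> (\<integral>x. (f x - r * g x)\<^sup>2 \<partial>M)" by simp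
    also have "\<dots> = (\<integral>x. (f x)\<^sup>2 - 2 * r * (f x * g x) + r\<^sup>2 * (g x)\<^sup>2 \<partial>M)"
      by (intro Bochner_Integration.integral_cong) (auto simp: power2_diff power_mult_distrib)
    also have "\<dots> = A - 2 * r * P + r\<^sup>2 * B"
      using assms integrable_mult_square_integrable[OF assms] by (simp add: A_def P_def B_def)
    finally show ?thesis .
  qed
  have "P\<^sup>2 \<le> A * B"
  proof (cases "B = 0")
    case True
    have "P = 0"
    proof (rule ccontr)
      assume "P \<noteq> 0"
      then show False using discr[of "(A + 1) / (2 * P)"] True by simp
    qed
    then show ?thesis using True by simp
  next
    case False
    moreover have "0 \<le> B" by (simp add: B_def)
    ultimately show ?thesis
      using discr[of "P / B"] by (simp add: field_simps power2_eq_square)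
  qed
  then show ?thesis by (simp add: A_def P_def B_def)
qed

definition L2_norm :: "(real \<Rightarrow> real) \<Rightarrow> real" where
  "L2_norm f = sqrt (LINT x|lborel. (f x)\<^sup>2)"

lemma L2_norm_nonneg [simp]: "0 \<le> L2_norm f"
  by (simp add: L2_norm_def)

lemma L2_norm_power2: "(L2_norm f)\<^sup>2 = (LINT x|lborel. (f x)\<^sup>2)"
  by (simp add: L2_norm_def)

lemma L2_measurable: "L2 f \<Longrightarrow> f \<in> borel_measurable borel"
  by (simp add: L2_def)

lemma L2_integrable_power2: "L2 f \<Longrightarrow> integrable lborel (\<lambda>x. (f x)\<^sup>2)"
  by (simp add: L2_def)

lemma L2_integrable_mult: "L2 f \<Longrightarrow> L2 g \<Longrightarrow> integrable lborel (\<lambda>x. f x * g x)"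
  by (intro integrable_mult_square_integrable) (auto simp: L2_def)

lemma L2_Cauchy_Schwarz:
  assumes "L2 f" "L2 g"
  shows "\<bar>LINT x|lborel. f x * g x\<bar> \<le> L2_norm f * L2_norm g"
proof -
  have "(LINT x|lborel. f x * g x)\<^sup>2 \<le> (LINT x|lborel. (f x)\<^sup>2) * (LINT x|lborel. (g x)\<^sup>2)"
    using assms by (intro Cauchy_Schwarz_integral) (auto simp: L2_def)
  from real_sqrt_le_mono[OF this] show ?thesis
    by (simp add: L2_norm_def real_sqrt_mult)
qed

lemma L2_cmult: "L2 f \<Longrightarrow> L2 (\<lambda>x. a * f x)"
  by (auto simp: L2_def power_mult_distrib)

lemma L2_norm_cmult: "L2_norm (\<lambda>x. a * f x) = \<bar>a\<bar> * L2_norm f"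
  by (simp add: L2_norm_def power_mult_distrib real_sqrt_mult)

lemma L2_diff:
  assumes "L2 f" "L2 g"
  shows "L2 (\<lambda>x. f x - g x)"
proof -
  have "integrable lborel (\<lambda>x. (f x)\<^sup>2 + (g x)\<^sup>2 - 2 * (f x * g x))"
    using assms L2_integrable_mult[OF assms] by (auto simp: L2_def)
  then show ?thesis using assms by (auto simp: L2_def power2_diff mult.assoc)
qed

lemma L2_norm_diff_le:
  assumes "L2 f" "L2 g"
  shows "L2_norm (\<lambda>x. f x - g x) \<le> L2_norm f + L2_norm g"
proof (rule power2_le_imp_le)
  have "(L2_norm (\<lambda>x. f x - g x))\<^sup>2 = (LINT x|lborel. (f x)\<^sup>2 + (g x)\<^sup>2 - 2 * (f x * g x))"
    unfolding L2_norm_power2 by (simp add: power2_diff mult.assoc)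
  also have "\<dots> = (L2_norm f)\<^sup>2 + (L2_norm g)\<^sup>2 - 2 * (LINT x|lborel. f x * g x)"
    using assms L2_integrable_mult[OF assms] by (simp add: L2_norm_power2 L2_def)
  also have "\<dots> \<le> (L2_norm f + L2_norm g)\<^sup>2"
    using L2_Cauchy_Schwarz[OF assms] by (simp add: power2_sum abs_le_iff)
  finally show "(L2_norm (\<lambda>x. f x - g x))\<^sup>2 \<le> (L2_norm f + L2_norm g)\<^sup>2" .
qed simp

lemma L2_mult_bounded:
  assumes "L2 f" "g \<in> borel_measurable borel" "\<And>x. \<bar>g x\<bar> \<le> B"
  shows "L2 (\<lambda>x. f x * g x)"
proof -
  have [measurable]: "f \<in> borel_measurable borel" "g \<in> borel_measurable borel"
    using assms by (auto simp: L2_def)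
  have "integrable lborel (\<lambda>x. (f x * g x)\<^sup>2)"
  proof (rule Bochner_Integration.integrable_bound)
    show "integrable lborel (\<lambda>x. (f x)\<^sup>2 * B\<^sup>2)"
      using assms(1) by (simp add: L2_def)
    have "(g x)\<^sup>2 \<le> B\<^sup>2" for x
      using power_mono[OF assms(3)[of x], of 2] by simp
    then show "AE x in lborel. norm ((f x * g x)\<^sup>2) \<le> norm ((f x)\<^sup>2 * B\<^sup>2)"
      by (simp add: power_mult_distrib mult_left_mono)
  qed measurable
  then show ?thesis by (simp add: L2_def)
qed

lemma L2_dilation:
  assumes "L2 f" "0 < R"
  shows "L2 (\<lambda>x. f (x / R))"
proof -
  have [measurable]: "f \<in> borel_measurable borel"
    by (rule L2_measurable[OF assms(1)])
  show ?thesis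
    using lborel_integrable_real_affine[of "\<lambda>x. (f x)\<^sup>2" "1 / R" 0] assms by (simp add: L2_def)
qed

lemma L2_norm_dilation:
  assumes "0 < R"
  shows "L2_norm (\<lambda>x. f (x / R)) = sqrt R * L2_norm f"
  using lborel_integral_real_affine[of "1 / R" "\<lambda>x. (f x)\<^sup>2" 0] assms
  by (simp add: L2_norm_def real_sqrt_mult[symmetric])

lemma
  assumes [measurable]: "f \<in> borel_measurable borel"
    and abs_f_le: "\<And>x. \<bar>f x\<bar> \<le> B * indicator {-r..r} x" and "0 \<le> r"
  shows L2_bounded_support: "L2 f"
    and L2_norm_bounded_support_le: "L2_norm f \<le> B * sqrt (2 * r)"
proof -
  have sq_le: "(f x)\<^sup>2 \<le> B\<^sup>2 * indicator {-r..r} x" for x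
    using power_mono[OF abs_f_le[of x], of 2] by (auto simp: indicator_def)
  have integrable_ind: "integrable lborel (\<lambda>x. B\<^sup>2 * indicator {-r..r} x)"
    by (intro integrable_mult_right integrable_real_indicator) (auto simp: emeasure_lborel_Icc_eq)
  have integrable_sq: "integrable lborel (\<lambda>x. (f x)\<^sup>2)"
    by (rule Bochner_Integration.integrable_bound[OF integrable_ind]) (use sq_le in auto)
  then show "L2 f" by (simp add: L2_def)
  have "0 \<le> B"
    using order_trans[OF abs_ge_zero abs_f_le[of 0]] assms(3) by simp
  have "(LINT x|lborel. (f x)\<^sup>2) \<le> (LINT x|lborel. B\<^sup>2 * indicator {-r..r} x)"
    by (rule integral_mono[OF integrable_sq integrable_ind sq_le])
  also have "\<dots> = B\<^sup>2 * (2 * r)" using assms(3) by simp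
  finally have "L2_norm f \<le> sqrt (B\<^sup>2 * (2 * r))"
    unfolding L2_norm_def by (rule real_sqrt_le_mono)
  then show "L2_norm f \<le> B * sqrt (2 * r)"
    using \<open>0 \<le> B\<close> by (simp only: real_sqrt_mult real_sqrt_abs abs_of_nonneg)
qed

section \<open>The Hilbert transform of compactly supported Lipschitz functions\<close>

text \<open>The odd kernel \<open>1 / z\<close> is symmetrised, so that the singularity at 0 cancels.\<close>
definition hilbert_kernel :: "(real \<Rightarrow> real) \<Rightarrow> real \<Rightarrow> real \<Rightarrow> real" where
  "hilbert_kernel h x z = (h (x - z) - h (x + z)) / (2 * z)"

locale compactly_supported_lipschitz =
  fixes h :: "real \<Rightarrow> real" and C r :: real
  assumes lipschitz: "C-lipschitz_on UNIV h"
    and support: "\<And>x. r \<le> \<bar>x\<bar> \<Longrightarrow> h x = 0"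
    and radius_pos: "0 < r"
begin

lemma lipschitz_const_nonneg: "0 \<le> C"
  using lipschitz by (rule lipschitz_on_nonneg)

lemma measurable_h [measurable]: "h \<in> borel_measurable borel"
  by (intro borel_measurable_continuous_onI lipschitz_on_continuous_on[OF lipschitz])

lemma abs_le_indicator: "\<bar>h x\<bar> \<le> 2 * C * r * indicator {-r..r} x"
proof (cases "\<bar>x\<bar> \<le> r")
  case True
  have "\<bar>h x - h r\<bar> \<le> C * \<bar>x - r\<bar>"
    using lipschitz_onD[OF lipschitz, of x r] by (simp add: dist_real_def)
  also have "\<dots> \<le> C * (2 * r)"
    using True lipschitz_const_nonneg by (intro mult_left_mono) auto
  finally show ?thesis using True support[of r] by (simp add: abs_le_iff)
qed (use support lipschitz_const_nonneg radius_pos in simp)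

lemma hilbert_kernel_measurable [measurable]:
  "(\<lambda>(x, z). hilbert_kernel h x z) \<in> borel_measurable (borel \<Otimes>\<^sub>M borel)"
  "hilbert_kernel h x \<in> borel_measurable borel"
  unfolding hilbert_kernel_def by measurable

lemma abs_hilbert_kernel_le:
  "\<bar>hilbert_kernel h x z\<bar> \<le> C * indicator {-(\<bar>x\<bar> + r)..\<bar>x\<bar> + r} z"
proof (cases "z \<in> {-(\<bar>x\<bar> + r)..\<bar>x\<bar> + r}")
  case True
  have "\<bar>h (x - z) - h (x + z)\<bar> \<le> C * (2 * \<bar>z\<bar>)"
    using lipschitz_onD[OF lipschitz, of "x - z" "x + z"] by (simp add: dist_real_def)
  then have "\<bar>h (x - z) - h (x + z)\<bar> / (2 * \<bar>z\<bar>) \<le> C"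
    using lipschitz_const_nonneg by (cases "z = 0") (auto simp: field_simps)
  then show ?thesis using True by (simp add: hilbert_kernel_def abs_mult)
next
  case False
  then have "h (x - z) = 0" "h (x + z) = 0" by (auto intro!: support)
  then show ?thesis using False by (simp add: hilbert_kernel_def)
qed

lemma abs_hilbert_kernel_le_const: "\<bar>hilbert_kernel h x z\<bar> \<le> C"
  using order_trans[OF abs_hilbert_kernel_le] lipschitz_const_nonneg
  by (simp add: mult_left_le indicator_def)

lemma
  shows integrable_hilbert_kernel: "integrable lborel (hilbert_kernel h x)"
    and abs_integral_hilbert_kernel_le: "\<bar>LINT z|lborel. hilbert_kernel h x z\<bar> \<le> 2 * C * (\<bar>x\<bar> + r)"
proof -
  let ?b = "\<lambda>z. C * indicator {-(\<bar>x\<bar> + r)..\<bar>x\<bar> + r} z"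
  have integrable_b: "integrable lborel ?b"
    by (intro integrable_mult_right integrable_real_indicator) (auto simp: emeasure_lborel_Icc_eq)
  then show integrable_k: "integrable lborel (hilbert_kernel h x)"
    by (rule Bochner_Integration.integrable_bound)
      (use abs_hilbert_kernel_le[of x] lipschitz_const_nonneg in auto)
  have "\<bar>LINT z|lborel. hilbert_kernel h x z\<bar> \<le> (LINT z|lborel. ?b z)"
    by (rule integral_abs_bound_integral[OF integrable_k integrable_b]) (rule abs_hilbert_kernel_le)
  then show "\<bar>LINT z|lborel. hilbert_kernel h x z\<bar> \<le> 2 * C * (\<bar>x\<bar> + r)"
    using radius_pos by (simp add: algebra_simps)
qed

lemma
  assumes "0 < \<epsilon>"
  shows truncated_hilbert_integrable:
      "set_integrable lborel {y. \<epsilon> < \<bar>x - y\<bar>} (\<lambda>y. h y / (x - y))"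
    and abs_truncated_hilbert_le:
      "\<bar>LINT y:{y. \<epsilon> < \<bar>x - y\<bar>}|lborel. h y / (x - y)\<bar> \<le> 4 * C * r\<^sup>2 / \<epsilon>"
proof -
  let ?f = "\<lambda>y. indicator {y. \<epsilon> < \<bar>x - y\<bar>} y *\<^sub>R (h y / (x - y))"
  let ?b = "\<lambda>y::real. (2 * C * r / \<epsilon>) * indicator {-r..r} y"
  have abs_f_le: "\<bar>?f y\<bar> \<le> ?b y" for y
  proof (cases "\<epsilon> < \<bar>x - y\<bar>")
    case True
    have "\<bar>h y\<bar> / \<bar>x - y\<bar> \<le> (2 * C * r * indicator {-r..r} y) / \<epsilon>"
      using True assms abs_le_indicator[of y] lipschitz_const_nonneg radius_pos
      by (intro frac_le) auto
    then show ?thesis using True by simp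
  qed (use assms lipschitz_const_nonneg radius_pos in simp)
  have integrable_b: "integrable lborel ?b"
    by (intro integrable_mult_right integrable_real_indicator) (auto simp: emeasure_lborel_Icc_eq)
  have integrable_f: "integrable lborel ?f"
  proof (rule Bochner_Integration.integrable_bound[OF integrable_b])
    show "AE y in lborel. norm (?f y) \<le> norm (?b y)"
      using abs_f_le by (intro AE_I2) (metis abs_ge_self order_trans real_norm_def)
  qed measurable
  then show "set_integrable lborel {y. \<epsilon> < \<bar>x - y\<bar>} (\<lambda>y. h y / (x - y))"
    by (simp add: set_integrable_def)
  have "\<bar>LINT y|lborel. ?f y\<bar> \<le> (LINT y|lborel. ?b y)"
    by (rule integral_abs_bound_integral[OF integrable_f integrable_b]) (rule abs_f_le)
  then show "\<bar>LINT y:{y. \<epsilon> < \<bar>x - y\<bar>}|lborel. h y / (x - y)\<bar> \<le> 4 * C * r\<^sup>2 / \<epsilon>"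
    using radius_pos by (simp add: set_lebesgue_integral_def power2_eq_square)
qed

lemma truncated_hilbert_eq:
  assumes "0 < \<epsilon>"
  shows "(LINT y:{y. \<epsilon> < \<bar>x - y\<bar>}|lborel. h y / (x - y))
    = (LINT z:{z. \<epsilon> < \<bar>z\<bar>}|lborel. hilbert_kernel h x z)"
proof -
  let ?f = "\<lambda>y. indicator {y. \<epsilon> < \<bar>x - y\<bar>} y *\<^sub>R (h y / (x - y))"
  have integrable_f: "integrable lborel ?f"
    using truncated_hilbert_integrable[OF assms] by (simp add: set_integrable_def)
  let ?p = "\<lambda>z. ?f (x + -1 * z)" and ?q = "\<lambda>z. ?f (x + 1 * z)"
  have integrable_pq: "integrable lborel ?p" "integrable lborel ?q"
    by (rule lborel_integrable_real_affine[OF integrable_f], simp)+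
  have "(LINT y|lborel. ?f y) = (LINT z|lborel. ?p z)"
    "(LINT y|lborel. ?f y) = (LINT z|lborel. ?q z)"
    using lborel_integral_real_affine[of "-1" ?f x] lborel_integral_real_affine[of 1 ?f x]
    by simp_all
  then have "(LINT y|lborel. ?f y) = (LINT z|lborel. ?p z) / 2 + (LINT z|lborel. ?q z) / 2"
    by simp
  also have "\<dots> = (LINT z|lborel. ?p z / 2 + ?q z / 2)"
    by (simp only: Bochner_Integration.integral_add[OF integrable_divide_zero integrable_divide_zero]
        integrable_pq integral_divide_zero)
  also have "\<dots> = (LINT z|lborel. indicator {z. \<epsilon> < \<bar>z\<bar>} z *\<^sub>R hilbert_kernel h x z)"
    by (intro Bochner_Integration.integral_cong)
      (auto simp: hilbert_kernel_def indicator_def diff_divide_distrib)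
  finally show ?thesis by (simp add: set_lebesgue_integral_def)
qed

lemma truncated_hilbert_error:
  assumes "0 < \<epsilon>"
  shows "\<bar>(LINT y:{y. \<epsilon> < \<bar>x - y\<bar>}|lborel. h y / (x - y)) - (LINT z|lborel. hilbert_kernel h x z)\<bar>
    \<le> 2 * C * \<epsilon>"
proof -
  let ?k = "hilbert_kernel h x" and ?I = "indicator {z. \<epsilon> < \<bar>z\<bar>} :: real \<Rightarrow> real"
  have integrable_trunc: "integrable lborel (\<lambda>z. ?I z *\<^sub>R ?k z)"
    by (intro integrable_mult_indicator integrable_hilbert_kernel) measurable
  have "(LINT y:{y. \<epsilon> < \<bar>x - y\<bar>}|lborel. h y / (x - y)) - (LINT z|lborel. ?k z)
      = (LINT z|lborel. ?I z *\<^sub>R ?k z - ?k z)"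
    unfolding truncated_hilbert_eq[OF assms] unfolding set_lebesgue_integral_def
    by (rule Bochner_Integration.integral_diff[symmetric,
          OF integrable_trunc integrable_hilbert_kernel])
  also have "\<bar>\<dots>\<bar> \<le> (LINT z|lborel. C * indicator {-\<epsilon>..\<epsilon>} z)"
  proof (rule integral_abs_bound_integral)
    show "integrable lborel (\<lambda>z. ?I z *\<^sub>R ?k z - ?k z)"
      by (rule Bochner_Integration.integrable_diff[OF integrable_trunc integrable_hilbert_kernel])
    show "integrable lborel (\<lambda>z. C * indicator {-\<epsilon>..\<epsilon>} z)"
      by (intro integrable_mult_right integrable_real_indicator) (auto simp: emeasure_lborel_Icc_eq)
    show "\<bar>?I z *\<^sub>R ?k z - ?k z\<bar> \<le> C * indicator {-\<epsilon>..\<epsilon>} z" for z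
      using abs_hilbert_kernel_le_const[of x z] by (auto simp: indicator_def)
  qed
  also have "\<dots> = 2 * C * \<epsilon>" using assms by simp
  finally show ?thesis .
qed

lemma hilbert_eq: "hilbert h x = (1 / pi) * (LINT z|lborel. hilbert_kernel h x z)"
proof -
  let ?J = "\<lambda>\<epsilon>. LINT y:{y. \<epsilon> < \<bar>x - y\<bar>}|lborel. h y / (x - y)"
  have "((\<lambda>\<epsilon>. ?J \<epsilon> - (LINT z|lborel. hilbert_kernel h x z)) \<longlongrightarrow> 0) (at_right 0)"
  proof (rule Lim_null_comparison)
    show "\<forall>\<^sub>F \<epsilon> in at_right 0. norm (?J \<epsilon> - (LINT z|lborel. hilbert_kernel h x z)) \<le> 2 * C * \<epsilon>"
      using eventually_at_right_less[of "0::real"]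
      by eventually_elim (use truncated_hilbert_error in simp)
    show "((\<lambda>\<epsilon>. 2 * C * \<epsilon>) \<longlongrightarrow> 0) (at_right 0)"
      by (rule tendsto_eq_intros refl | simp)+
  qed
  then have "(?J \<longlongrightarrow> (LINT z|lborel. hilbert_kernel h x z)) (at_right 0)"
    by (simp add: LIM_zero_iff)
  then show ?thesis
    unfolding hilbert_def by (intro tendsto_Lim tendsto_mult_left) auto
qed

text \<open>
  For \<open>2 * r < \<bar>x\<bar>\<close> the singularity lies off the support, and truncating at \<open>\<bar>x\<bar> / 2\<close> loses nothing.
\<close>
lemma integral_hilbert_kernel_decay:
  "\<bar>LINT z|lborel. hilbert_kernel h x z\<bar> \<le> 18 * C * r\<^sup>2 / (r + \<bar>x\<bar>)"
proof (cases "\<bar>x\<bar> \<le> 2 * r")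
  case True
  have "\<bar>LINT z|lborel. hilbert_kernel h x z\<bar> * (r + \<bar>x\<bar>) \<le> (2 * C * (3 * r)) * (3 * r)"
    using True radius_pos lipschitz_const_nonneg
    by (intro mult_mono order_trans[OF abs_integral_hilbert_kernel_le] mult_left_mono) auto
  then show ?thesis
    using radius_pos by (simp add: field_simps power2_eq_square)
next
  case False
  have "hilbert_kernel h x z = 0" if "\<bar>z\<bar> \<le> \<bar>x\<bar> / 2" for z
    using that False support[of "x - z"] support[of "x + z"] by (simp add: hilbert_kernel_def)
  then have "(LINT z|lborel. hilbert_kernel h x z)
      = (LINT z:{z. \<bar>x\<bar> / 2 < \<bar>z\<bar>}|lborel. hilbert_kernel h x z)"
    unfolding set_lebesgue_integral_def
    by (intro Bochner_Integration.integral_cong) (auto simp: indicator_def not_less)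
  then have "\<bar>LINT z|lborel. hilbert_kernel h x z\<bar> \<le> 4 * C * r\<^sup>2 / (\<bar>x\<bar> / 2)"
    using truncated_hilbert_eq[of "\<bar>x\<bar> / 2" x] abs_truncated_hilbert_le[of "\<bar>x\<bar> / 2" x]
      False radius_pos by simp
  also have "\<dots> = C * r\<^sup>2 * (8 / \<bar>x\<bar>)" by simp
  also have "\<dots> \<le> C * r\<^sup>2 * (18 / (r + \<bar>x\<bar>))"
    using False radius_pos lipschitz_const_nonneg
    by (intro mult_left_mono) (auto simp: field_simps)
  finally show ?thesis by (simp add: ac_simps)
qed

lemma L2_hilbert: "L2 (hilbert h)"
proof -
  have [measurable]: "hilbert h \<in> borel_measurable borel"
    unfolding hilbert_eq[abs_def] by measurable
  define K where "K = 18 * C * r / pi"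
  have decay: "(hilbert h x)\<^sup>2 \<le> K\<^sup>2 * inverse (1 + (x / r)\<^sup>2)" for x
  proof -
    have "\<bar>hilbert h x\<bar> \<le> (1 / pi) * (18 * C * r\<^sup>2 / (r + \<bar>x\<bar>))"
      unfolding hilbert_eq abs_mult using integral_hilbert_kernel_decay[of x]
      by (intro mult_mono) auto
    also have "\<dots> = K / (1 + \<bar>x / r\<bar>)"
      using radius_pos by (simp add: K_def field_simps power2_eq_square)
    finally have "(hilbert h x)\<^sup>2 \<le> K\<^sup>2 / (1 + \<bar>x / r\<bar>)\<^sup>2"
      using power_mono[of "\<bar>hilbert h x\<bar>" "K / (1 + \<bar>x / r\<bar>)" 2] by (simp add: power_divide)
    also have "\<dots> \<le> K\<^sup>2 / (1 + (x / r)\<^sup>2)"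
      by (intro divide_left_mono)
        (auto simp: power2_sum simp del: abs_divide intro!: add_pos_nonneg mult_pos_pos)
    finally show ?thesis by (simp add: divide_inverse)
  qed
  have "integrable lborel (\<lambda>x::real. inverse (1 + x\<^sup>2))"
    using integrable_inverse_1_plus_square by (simp add: set_integrable_def einterval_def)
  then have "integrable lborel (\<lambda>x. inverse (1 + (x / r)\<^sup>2))"
    using lborel_integrable_real_affine[of "\<lambda>x. inverse (1 + x\<^sup>2)" "1 / r" 0] radius_pos by simp
  then have "integrable lborel (\<lambda>x. K\<^sup>2 * inverse (1 + (x / r)\<^sup>2))"
    by (rule integrable_mult_right)
  then have "integrable lborel (\<lambda>x. (hilbert h x)\<^sup>2)"
    by (rule Bochner_Integration.integrable_bound) (use decay in auto)
  then show ?thesis by (simp add: L2_def)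
qed

end

lemma test_fun_compactly_supported_lipschitz:
  assumes "test_fun \<phi>"
  obtains C r where "compactly_supported_lipschitz \<phi> C r"
proof -
  obtain C where "C-lipschitz_on UNIV \<phi>" by (rule test_fun_lipschitz[OF assms])
  moreover obtain r where "0 < r" "\<And>x. r \<le> \<bar>x\<bar> \<Longrightarrow> \<phi> x = 0" using test_fun_support[OF assms] by blast
  ultimately show ?thesis
    by (intro that compactly_supported_lipschitz.intro)
qed

lemma L2_hilbert_test_fun: "test_fun \<phi> \<Longrightarrow> L2 (hilbert \<phi>)"
  using test_fun_compactly_supported_lipschitz compactly_supported_lipschitz.L2_hilbert by metis

lemma hilbert_test_fun_eq:
  "test_fun \<phi> \<Longrightarrow> hilbert \<phi> x = (1 / pi) * (LINT z|lborel. hilbert_kernel \<phi> x z)"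
  using test_fun_compactly_supported_lipschitz compactly_supported_lipschitz.hilbert_eq by metis

lemma integrable_hilbert_kernel_test_fun: "test_fun \<phi> \<Longrightarrow> integrable lborel (hilbert_kernel \<phi> x)"
  using test_fun_compactly_supported_lipschitz compactly_supported_lipschitz.integrable_hilbert_kernel
  by metis

lemma hilbert_diff:
  assumes "test_fun \<phi>" "test_fun \<psi>"
  shows "hilbert (\<lambda>x. \<phi> x - \<psi> x) = (\<lambda>x. hilbert \<phi> x - hilbert \<psi> x)"
proof
  fix x
  have "hilbert_kernel (\<lambda>x. \<phi> x - \<psi> x) x z = hilbert_kernel \<phi> x z - hilbert_kernel \<psi> x z" for z
    by (simp add: hilbert_kernel_def diff_divide_distrib[symmetric])
  then show "hilbert (\<lambda>x. \<phi> x - \<psi> x) x = hilbert \<phi> x - hilbert \<psi> x"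
    using assms
    by (simp add: hilbert_test_fun_eq test_fun_diff integrable_hilbert_kernel_test_fun
        right_diff_distrib diff_divide_distrib)
qed

lemma hilbert_scale:
  assumes "test_fun \<phi>" "0 < R"
  shows "hilbert (\<lambda>x. a * \<phi> (x / R)) = (\<lambda>x. a * hilbert \<phi> (x / R))"
proof
  fix x
  let ?k = "hilbert_kernel (\<lambda>x. a * \<phi> (x / R)) x"
  have "?k (0 + R * z) = (a / R) * hilbert_kernel \<phi> (x / R) z" for z
    using assms(2)
    by (simp add: hilbert_kernel_def add_divide_distrib diff_divide_distrib right_diff_distrib)
  then have "(LINT z|lborel. ?k z) = a * (LINT z|lborel. hilbert_kernel \<phi> (x / R) z)"
    using lborel_integral_real_affine[of R ?k 0] assms(2) by simp
  then show "hilbert (\<lambda>x. a * \<phi> (x / R)) x = a * hilbert \<phi> (x / R)"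
    using assms by (simp add: hilbert_test_fun_eq test_fun_scale)
qed

section \<open>The weak formulation\<close>

definition BO_flux :: "(real \<Rightarrow> real) \<Rightarrow> (real \<Rightarrow> real) \<Rightarrow> real" where
  "BO_flux \<phi> v = (LINT x|lborel. - v x * hilbert (deriv (deriv \<phi>)) x + (v x)\<^sup>2 / 2 * deriv \<phi> x)"

lemma L2_hilbert_deriv2: "test_fun \<phi> \<Longrightarrow> L2 (hilbert (deriv (deriv \<phi>)))"
  by (intro L2_hilbert_test_fun test_fun_deriv)

lemma L2_mult_test_fun:
  assumes "L2 v" "test_fun \<psi>"
  shows "L2 (\<lambda>x. v x * \<psi> x)"
proof -
  obtain B where "\<And>x. \<bar>\<psi> x\<bar> \<le> B"
    using test_fun_bounded[OF assms(2)] by blast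
  then show ?thesis by (rule L2_mult_bounded[OF assms(1) test_fun_measurable[OF assms(2)]])
qed

lemma integrable_power2_mult_test_fun:
  "L2 v \<Longrightarrow> test_fun \<psi> \<Longrightarrow> integrable lborel (\<lambda>x. (v x)\<^sup>2 * \<psi> x)"
  using L2_integrable_mult[OF _ L2_mult_test_fun] by (simp add: power2_eq_square mult.assoc)

lemma BO_flux_eq:
  assumes "test_fun \<phi>" "L2 v"
  shows "BO_flux \<phi> v = (LINT x|lborel. (v x)\<^sup>2 * deriv \<phi> x) / 2
    - (LINT x|lborel. v x * hilbert (deriv (deriv \<phi>)) x)"
proof -
  have "BO_flux \<phi> v
      = (LINT x|lborel. (v x)\<^sup>2 * deriv \<phi> x / 2 - v x * hilbert (deriv (deriv \<phi>)) x)"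
    unfolding BO_flux_def by (intro Bochner_Integration.integral_cong) auto
  also have "\<dots> = (LINT x|lborel. (v x)\<^sup>2 * deriv \<phi> x / 2)
      - (LINT x|lborel. v x * hilbert (deriv (deriv \<phi>)) x)"
    using assms
    by (intro Bochner_Integration.integral_diff integrable_divide integrable_power2_mult_test_fun
        L2_integrable_mult L2_hilbert_deriv2 test_fun_deriv)
  finally show ?thesis by simp
qed

lemma BO_flux_diff:
  assumes "test_fun \<phi>" and L2_v: "L2 v" and L2_w: "L2 w"
  defines "d \<equiv> \<lambda>x. v x - w x"
  shows "BO_flux \<phi> v - BO_flux \<phi> w = (LINT x|lborel. (d x)\<^sup>2 * deriv \<phi> x) / 2
    + (LINT x|lborel. d x * (w x * deriv \<phi> x)) - (LINT x|lborel. d x * hilbert (deriv (deriv \<phi>)) x)"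
proof -
  let ?k = "hilbert (deriv (deriv \<phi>))"
  have L2_d: "L2 d" unfolding d_def by (rule L2_diff[OF L2_v L2_w])
  have test_\<phi>': "test_fun (deriv \<phi>)" by (rule test_fun_deriv[OF assms(1)])
  have integrable_mult_k: "integrable lborel (\<lambda>x. f x * ?k x)" if "L2 f" for f
    by (rule L2_integrable_mult[OF that L2_hilbert_deriv2[OF assms(1)]])
  have "(LINT x|lborel. (v x)\<^sup>2 * deriv \<phi> x) - (LINT x|lborel. (w x)\<^sup>2 * deriv \<phi> x)
      = (LINT x|lborel. (v x)\<^sup>2 * deriv \<phi> x - (w x)\<^sup>2 * deriv \<phi> x)"
    using L2_v L2_w test_\<phi>' by (simp add: integrable_power2_mult_test_fun)
  also have "\<dots> = (LINT x|lborel. (d x)\<^sup>2 * deriv \<phi> x + 2 * (d x * (w x * deriv \<phi> x)))"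
    by (intro Bochner_Integration.integral_cong refl) (simp add: d_def power2_eq_square algebra_simps)
  also have "\<dots> = (LINT x|lborel. (d x)\<^sup>2 * deriv \<phi> x) + 2 * (LINT x|lborel. d x * (w x * deriv \<phi> x))"
    using integrable_power2_mult_test_fun[OF L2_d test_\<phi>']
      L2_integrable_mult[OF L2_d L2_mult_test_fun[OF L2_w test_\<phi>']]
    by simp
  finally have quadratic: "(LINT x|lborel. (v x)\<^sup>2 * deriv \<phi> x) - (LINT x|lborel. (w x)\<^sup>2 * deriv \<phi> x)
      = (LINT x|lborel. (d x)\<^sup>2 * deriv \<phi> x) + 2 * (LINT x|lborel. d x * (w x * deriv \<phi> x))" .
  have linear: "(LINT x|lborel. d x * ?k x)
      = (LINT x|lborel. v x * ?k x) - (LINT x|lborel. w x * ?k x)"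
    using integrable_mult_k[OF L2_v] integrable_mult_k[OF L2_w] by (simp add: d_def left_diff_distrib)
  show ?thesis
    unfolding BO_flux_eq[OF assms(1) L2_v] BO_flux_eq[OF assms(1) L2_w] linear using quadratic by argo
qed

lemma abs_BO_flux_diff_le:
  assumes "test_fun \<phi>" "L2 v" "L2 w" and deriv_le: "\<And>x. \<bar>deriv \<phi> x\<bar> \<le> B"
  defines "\<delta> \<equiv> L2_norm (\<lambda>x. v x - w x)"
  shows "\<bar>BO_flux \<phi> v - BO_flux \<phi> w\<bar> \<le> \<delta>\<^sup>2 * B / 2
    + \<delta> * L2_norm (\<lambda>x. w x * deriv \<phi> x) + \<delta> * L2_norm (hilbert (deriv (deriv \<phi>)))"
proof -
  define d where "d = (\<lambda>x. v x - w x)"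
  have L2_d: "L2 d" unfolding d_def by (rule L2_diff[OF assms(2,3)])
  have test_\<phi>': "test_fun (deriv \<phi>)" by (rule test_fun_deriv[OF assms(1)])
  have "\<bar>LINT x|lborel. (d x)\<^sup>2 * deriv \<phi> x\<bar> \<le> (LINT x|lborel. (d x)\<^sup>2 * B)"
    using L2_d test_\<phi>' deriv_le by (intro integral_abs_bound_integral)
      (auto simp: L2_integrable_power2 integrable_power2_mult_test_fun abs_mult mult_left_mono)
  also have "\<dots> = \<delta>\<^sup>2 * B" by (simp add: \<delta>_def L2_norm_power2 d_def)
  finally have "\<bar>LINT x|lborel. (d x)\<^sup>2 * deriv \<phi> x\<bar> \<le> \<delta>\<^sup>2 * B" .
  moreover have "\<bar>LINT x|lborel. d x * (w x * deriv \<phi> x)\<bar> \<le> \<delta> * L2_norm (\<lambda>x. w x * deriv \<phi> x)"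
    using L2_Cauchy_Schwarz[OF L2_d L2_mult_test_fun[OF assms(3) test_\<phi>']] by (simp add: \<delta>_def d_def)
  moreover have "\<bar>LINT x|lborel. d x * hilbert (deriv (deriv \<phi>)) x\<bar>
      \<le> \<delta> * L2_norm (hilbert (deriv (deriv \<phi>)))"
    using L2_Cauchy_Schwarz[OF L2_d L2_hilbert_deriv2[OF assms(1)]] by (simp add: \<delta>_def d_def)
  ultimately show ?thesis
    unfolding BO_flux_diff[OF assms(1-3)] d_def by linarith
qed

lemma continuous_BO_flux:
  assumes "C_L2 u" "test_fun \<phi>"
  shows "isCont (\<lambda>t. BO_flux \<phi> (\<lambda>x. u x t)) t"
proof -
  obtain B where deriv_le: "\<And>x. \<bar>deriv \<phi> x\<bar> \<le> B"
    using test_fun_bounded[OF test_fun_deriv[OF assms(2)]] by blast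
  have L2_u: "L2 (\<lambda>x. u x s)" for s using assms(1) by (simp add: C_L2_def)
  define \<delta> where "\<delta> s = L2_norm (\<lambda>x. u x s - u x t)" for s
  have "((\<lambda>s. LINT x|lborel. (u x s - u x t)\<^sup>2) \<longlongrightarrow> 0) (at t)"
    using assms(1) by (simp add: C_L2_def)
  then have \<delta>_tendsto: "(\<delta> \<longlongrightarrow> 0) (at t)"
    using tendsto_real_sqrt unfolding \<delta>_def L2_norm_def by fastforce
  have "((\<lambda>s. BO_flux \<phi> (\<lambda>x. u x s) - BO_flux \<phi> (\<lambda>x. u x t)) \<longlongrightarrow> 0) (at t)"
  proof (rule Lim_null_comparison[OF always_eventually[OF allI]])
    show "norm (BO_flux \<phi> (\<lambda>x. u x s) - BO_flux \<phi> (\<lambda>x. u x t)) \<le> (\<delta> s)\<^sup>2 * B / 2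
        + \<delta> s * L2_norm (\<lambda>x. u x t * deriv \<phi> x) + \<delta> s * L2_norm (hilbert (deriv (deriv \<phi>)))" for s
      unfolding \<delta>_def real_norm_def by (rule abs_BO_flux_diff_le[OF assms(2) L2_u L2_u deriv_le])
    show "((\<lambda>s. (\<delta> s)\<^sup>2 * B / 2 + \<delta> s * L2_norm (\<lambda>x. u x t * deriv \<phi> x)
        + \<delta> s * L2_norm (hilbert (deriv (deriv \<phi>)))) \<longlongrightarrow> 0) (at t)"
      by (rule tendsto_eq_intros refl \<delta>_tendsto | simp)+
  qed
  then show ?thesis by (simp add: isCont_def LIM_zero_iff)
qed

lemma BO_solution_L2: "BO_solution u0 u \<Longrightarrow> L2 (\<lambda>x. u x t)"
  by (simp add: BO_solution_def C_L2_def)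

lemma BO_solution_L2_norm_bounded:
  assumes "BO_solution u0 u"
  obtains M where "\<And>t. L2_norm (\<lambda>x. u x t) \<le> M"
proof -
  obtain M where "\<And>t. (LINT x|lborel. (u x t)\<^sup>2) \<le> M"
    using assms by (auto simp: BO_solution_def Linf_L2_def)
  then show ?thesis
    by (intro that[of "sqrt M"]) (simp add: L2_norm_def)
qed

lemma BO_solution_DERIV:
  assumes "BO_solution u0 u" "test_fun \<phi>"
  shows "((\<lambda>t. LINT x|lborel. u x t * \<phi> x) has_real_derivative BO_flux \<phi> (\<lambda>x. u x t)) (at t)"
proof -
  have "(\<lambda>t. LINT x|lborel. u x t * \<phi> x)
      = (\<lambda>t. (LINT x|lborel. u0 x * \<phi> x) + (LBINT s=ereal 0..t. BO_flux \<phi> (\<lambda>x. u x s)))"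
    using assms unfolding BO_solution_def BO_flux_def zero_ereal_def by blast
  moreover have "C_L2 u" using assms(1) by (simp add: BO_solution_def)
  then have "continuous_on UNIV (\<lambda>t. BO_flux \<phi> (\<lambda>x. u x t))"
    by (intro continuous_at_imp_continuous_on ballI continuous_BO_flux assms(2))
  from DERIV_add[OF DERIV_const DERIV_interval_integral[OF this]]
  have "((\<lambda>t. (LINT x|lborel. u0 x * \<phi> x) + (LBINT s=ereal 0..t. BO_flux \<phi> (\<lambda>x. u x s)))
      has_real_derivative BO_flux \<phi> (\<lambda>x. u x t)) (at t)"
    by simp
  ultimately show ?thesis by simp
qed

lemma BO_flux_small_at_some_time:
  assumes "BO_solution u0 u" "test_fun \<phi>" "L2 \<phi>"
    and norm_le_M: "\<And>t. L2_norm (\<lambda>x. u x t) \<le> M" and "T1 < T2"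
  obtains s where "T1 < s" "s < T2" "(T2 - T1) * BO_flux \<phi> (\<lambda>x. u x s) \<le> 2 * M * L2_norm \<phi>"
proof -
  have pairing: "\<bar>LINT x|lborel. u x t * \<phi> x\<bar> \<le> M * L2_norm \<phi>" for t
    using L2_Cauchy_Schwarz[OF BO_solution_L2[OF assms(1)] assms(3)]
    by (rule order_trans) (intro mult_right_mono norm_le_M L2_norm_nonneg)
  obtain s where "T1 < s" "s < T2" and
    "(LINT x|lborel. u x T2 * \<phi> x) - (LINT x|lborel. u x T1 * \<phi> x)
      = (T2 - T1) * BO_flux \<phi> (\<lambda>x. u x s)"
    using MVT2[OF assms(5) BO_solution_DERIV[OF assms(1,2)]] by blast
  then show ?thesis
    using pairing[of T1] pairing[of T2] by (intro that[of s]) auto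
qed

section \<open>The two-scale test function\<close>

definition two_scale :: "real \<Rightarrow> real \<Rightarrow> real \<Rightarrow> real" where
  "two_scale R L x = R * (bump_primitive (x / R) - bump_primitive (x / L))"

lemma DERIV_two_scale:
  assumes "0 < R"
  shows "(two_scale R L has_real_derivative bump (x / R) - (R / L) * bump (x / L)) (at x)"
  unfolding two_scale_def[abs_def] using assms
  by (intro DERIV_cong[OF DERIV_cmult[OF DERIV_diff[OF DERIV_dilation DERIV_dilation]],
        OF DERIV_bump_primitive DERIV_bump_primitive]) (simp add: field_simps)

context
  fixes R L :: real
  assumes R_pos: "0 < R" and R_le_L: "R \<le> L"
begin

lemma deriv_two_scale: "deriv (two_scale R L) = (\<lambda>x. bump (x / R) - (R / L) * bump (x / L))"
  by (intro ext DERIV_imp_deriv DERIV_two_scale R_pos)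

lemma two_scale_eq_0:
  assumes "L \<le> \<bar>x\<bar>"
  shows "two_scale R L x = 0"
proof -
  have "0 < L" using R_pos R_le_L by simp
  moreover from this have "1 \<le> \<bar>x / R\<bar>" "1 \<le> \<bar>x / L\<bar>"
    using assms R_pos R_le_L by auto
  from this[THEN bump_primitive_constant] have
    "bump_primitive (x / R) = bump_primitive (sgn (x / R))"
    "bump_primitive (x / L) = bump_primitive (sgn (x / L))" .
  ultimately show ?thesis
    using R_pos by (simp add: two_scale_def sgn_divide)
qed

lemma test_fun_two_scale: "test_fun (two_scale R L)"
proof (rule test_fun_antiderivative[where r = L])
  show "(two_scale R L has_real_derivative bump (x / R) - (R / L) * bump (x / L)) (at x)" for x
    by (rule DERIV_two_scale[OF R_pos])
  show "test_fun (\<lambda>x. bump (x / R) - (R / L) * bump (x / L))"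
    using test_fun_scale[OF test_fun_bump, of R 1] test_fun_scale[OF test_fun_bump, of L "R / L"]
      R_pos R_le_L by (intro test_fun_diff) auto
qed (rule two_scale_eq_0, simp)

lemma
  shows L2_two_scale: "L2 (two_scale R L)"
    and L2_norm_two_scale_le: "L2_norm (two_scale R L) \<le> 2 * R * sqrt (2 * L)"
proof -
  have "\<bar>bump_primitive (x / R) - bump_primitive (x / L)\<bar> \<le> 2" for x
    using abs_bump_primitive_le[of "x / R"] abs_bump_primitive_le[of "x / L"] by linarith
  then have "\<bar>two_scale R L x\<bar> \<le> 2 * R" for x
    using R_pos by (simp add: two_scale_def abs_mult)
  then have abs_two_scale_le: "\<bar>two_scale R L x\<bar> \<le> 2 * R * indicator {-L..L} x" for x
    using two_scale_eq_0[of x] by (cases "\<bar>x\<bar> \<le> L") (auto simp: abs_le_iff)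
  have measurable_two_scale: "two_scale R L \<in> borel_measurable borel"
    by (rule test_fun_measurable[OF test_fun_two_scale])
  show "L2 (two_scale R L)" "L2_norm (two_scale R L) \<le> 2 * R * sqrt (2 * L)"
    using L2_bounded_support[OF measurable_two_scale abs_two_scale_le]
      L2_norm_bounded_support_le[OF measurable_two_scale abs_two_scale_le] R_pos R_le_L by auto
qed

lemma L2_norm_hilbert_two_scale_le:
  "L2_norm (hilbert (deriv (deriv (two_scale R L)))) \<le> 2 * L2_norm (hilbert (deriv bump)) / sqrt R"
proof -
  define K where "K = hilbert (deriv bump)"
  have L_pos: "0 < L" using R_pos R_le_L by simp
  have test_bump': "test_fun (deriv bump)" by (rule test_fun_deriv[OF test_fun_bump])
  have L2_K: "L2 K" unfolding K_def by (rule L2_hilbert_test_fun[OF test_bump'])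
  note bump_dilation = DERIV_dilation[OF test_fun_DERIV[OF test_fun_bump]]
  have "((\<lambda>x. bump (x / R) - (R / L) * bump (x / L)) has_real_derivative
      (1 / R) * deriv bump (x / R) - (R / L\<^sup>2) * deriv bump (x / L)) (at x)" for x
    by (rule DERIV_cong[OF DERIV_diff[OF bump_dilation DERIV_cmult[OF bump_dilation]]])
      (simp add: power2_eq_square)
  then have "deriv (deriv (two_scale R L))
      = (\<lambda>x. (1 / R) * deriv bump (x / R) - (R / L\<^sup>2) * deriv bump (x / L))"
    unfolding deriv_two_scale by (intro ext DERIV_imp_deriv)
  then have "hilbert (deriv (deriv (two_scale R L)))
      = (\<lambda>x. (1 / R) * K (x / R) - (R / L\<^sup>2) * K (x / L))"
    using test_bump' R_pos L_pos by (simp only: hilbert_diff hilbert_scale test_fun_scale K_def)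
  then have "L2_norm (hilbert (deriv (deriv (two_scale R L))))
      \<le> L2_norm (\<lambda>x. (1 / R) * K (x / R)) + L2_norm (\<lambda>x. (R / L\<^sup>2) * K (x / L))"
    using L2_K R_pos L_pos by (simp only: L2_norm_diff_le L2_cmult L2_dilation)
  also have "\<dots> = L2_norm K * (sqrt R / R) + L2_norm K * (R / L\<^sup>2 * sqrt L)"
    unfolding L2_norm_cmult L2_norm_dilation[OF R_pos] L2_norm_dilation[OF L_pos]
    using R_pos L_pos by (simp add: ac_simps)
  also have "\<dots> \<le> L2_norm K * (1 / sqrt R) + L2_norm K * (1 / sqrt R)"
  proof (intro add_mono mult_left_mono L2_norm_nonneg)
    show "sqrt R / R \<le> 1 / sqrt R" using R_pos by (simp add: field_simps)
    have "R / L\<^sup>2 * sqrt L = R / L * (1 / sqrt L)"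
      using L_pos by (simp add: field_simps power2_eq_square)
    also have "\<dots> \<le> 1 * (1 / sqrt R)"
      using R_pos R_le_L by (intro mult_mono divide_left_mono) auto
    finally show "R / L\<^sup>2 * sqrt L \<le> 1 / sqrt R" by simp
  qed
  finally show ?thesis by (simp add: K_def)
qed

end

section \<open>Local mass\<close>

definition mass_within :: "real \<Rightarrow> (real \<Rightarrow> real) \<Rightarrow> real" where
  "mass_within r v = (LINT x:{x. \<bar>x\<bar> < r}|lborel. (v x)\<^sup>2)"

lemma mass_within_nonneg: "0 \<le> mass_within r v"
  by (simp add: mass_within_def set_lebesgue_integral_def)

lemma mass_within_mono:
  assumes "L2 v" "r \<le> r'"
  shows "mass_within r v \<le> mass_within r' v"
  unfolding mass_within_def set_lebesgue_integral_def using assms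
  by (intro integral_mono integrable_mult_indicator L2_integrable_power2) (auto simp: indicator_def)

lemma weighted_mass_two_scale_ge:
  assumes "L2 v" "0 < R" "R \<le> L"
  shows "exp (- 4 / 3) * mass_within (R / 2) v - R / L * (L2_norm v)\<^sup>2
    \<le> (LINT x|lborel. (v x)\<^sup>2 * deriv (two_scale R L) x)"
proof -
  let ?I = "indicator {x. \<bar>x\<bar> < R / 2} :: real \<Rightarrow> real"
  have integrable_v: "integrable lborel (\<lambda>x. (v x)\<^sup>2)"
    by (rule L2_integrable_power2[OF assms(1)])
  have integrable_Iv: "integrable lborel (\<lambda>x. ?I x * (v x)\<^sup>2)"
    using integrable_mult_indicator[OF _ integrable_v, of "{x. \<bar>x\<bar> < R / 2}"] by simp
  have deriv_ge: "exp (- 4 / 3) * ?I x - R / L \<le> deriv (two_scale R L) x" for x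
  proof -
    have "exp (- 4 / 3) * ?I x \<le> bump (x / R)"
      using bump_ge[of "x / R"] bump_nonneg[of "x / R"] assms(2)
      by (auto simp: indicator_def field_simps)
    moreover have "R / L * bump (x / L) \<le> R / L * 1"
      using assms(2,3) bump_le_1 by (intro mult_left_mono) auto
    ultimately show ?thesis by (simp add: deriv_two_scale[OF assms(2,3)])
  qed
  have "exp (- 4 / 3) * mass_within (R / 2) v - R / L * (L2_norm v)\<^sup>2
      = (LINT x|lborel. exp (- 4 / 3) * (?I x * (v x)\<^sup>2) - R / L * (v x)\<^sup>2)"
    using integrable_v integrable_Iv
    by (simp add: mass_within_def set_lebesgue_integral_def L2_norm_power2)
  also have "\<dots> \<le> (LINT x|lborel. (v x)\<^sup>2 * deriv (two_scale R L) x)"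
  proof (rule integral_mono)
    show "exp (- 4 / 3) * (?I x * (v x)\<^sup>2) - R / L * (v x)\<^sup>2 \<le> (v x)\<^sup>2 * deriv (two_scale R L) x" for x
      using mult_left_mono[OF deriv_ge[of x], of "(v x)\<^sup>2"] by (simp add: algebra_simps)
  qed (use integrable_v integrable_Iv assms in
      \<open>auto intro: integrable_power2_mult_test_fun test_fun_deriv test_fun_two_scale\<close>)
  finally show ?thesis .
qed

lemma BO_flux_two_scale_ge:
  assumes "L2 v" "L2_norm v \<le> M" "0 < R" "R \<le> L"
  shows "exp (- 4 / 3) * mass_within (R / 2) v
    \<le> 2 * BO_flux (two_scale R L) v + M\<^sup>2 * (R / L)
      + 4 * M * L2_norm (hilbert (deriv bump)) * (1 / sqrt R)"
proof -
  let ?\<phi> = "two_scale R L"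
  define N where "N = L2_norm (hilbert (deriv bump))"
  have test_\<phi>: "test_fun ?\<phi>" by (rule test_fun_two_scale[OF assms(3,4)])
  have "0 \<le> M" using L2_norm_nonneg assms(2) by (rule order_trans)
  have "(LINT x|lborel. v x * hilbert (deriv (deriv ?\<phi>)) x)
      \<le> L2_norm v * L2_norm (hilbert (deriv (deriv ?\<phi>)))"
    using L2_Cauchy_Schwarz[OF assms(1) L2_hilbert_deriv2[OF test_\<phi>]] by simp
  also have "\<dots> \<le> M * (2 * N / sqrt R)"
    unfolding N_def using assms(2) L2_norm_hilbert_two_scale_le[OF assms(3,4)] \<open>0 \<le> M\<close>
    by (intro mult_mono) auto
  finally have dispersive: "(LINT x|lborel. v x * hilbert (deriv (deriv ?\<phi>)) x)
      \<le> 2 * (M * N * (1 / sqrt R))" by (simp add: ac_simps)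
  have "R / L * (L2_norm v)\<^sup>2 \<le> M\<^sup>2 * (R / L)"
    using mult_left_mono[OF power_mono[OF assms(2), of 2], of "R / L"] assms(3,4)
    by (simp add: mult.commute)
  with weighted_mass_two_scale_ge[OF assms(1,3,4)] dispersive show ?thesis
    unfolding BO_flux_eq[OF test_\<phi> assms(1)] N_def by argo
qed

lemma mass_within_small_at_some_time:
  assumes sol: "BO_solution u0 u"
  obtains A where "\<And>T R L. 0 < T \<Longrightarrow> 0 < R \<Longrightarrow> R \<le> L \<Longrightarrow>
    \<exists>s\<in>{T..2 * T}. mass_within (R / 2) (\<lambda>x. u x s) \<le> A * (R * sqrt L / T + R / L + 1 / sqrt R)"
proof -
  obtain M where norm_le_M: "\<And>t. L2_norm (\<lambda>x. u x t) \<le> M"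
    using BO_solution_L2_norm_bounded[OF sol] by blast
  have "0 \<le> M" using L2_norm_nonneg norm_le_M by (rule order_trans)
  define N where "N = L2_norm (hilbert (deriv bump))"
  define P where "P = 8 * M * sqrt 2 + M\<^sup>2 + 4 * M * N"
  have coefficients_le: "8 * M * sqrt 2 \<le> P" "M\<^sup>2 \<le> P" "4 * M * N \<le> P"
    using \<open>0 \<le> M\<close> by (auto simp: P_def N_def)
  show ?thesis
  proof (rule that[of "P / exp (- 4 / 3)"])
    fix T R L :: real
    assume "0 < T" and radii: "0 < R" "R \<le> L"
    obtain s where s_between: "T < s" "s < 2 * T"
      and flux: "(2 * T - T) * BO_flux (two_scale R L) (\<lambda>x. u x s)
        \<le> 2 * M * L2_norm (two_scale R L)"
      using BO_flux_small_at_some_time[OF sol test_fun_two_scale[OF radii] L2_two_scale[OF radii]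
          norm_le_M, of T "2 * T"] \<open>0 < T\<close> by auto
    note flux
    also have "2 * M * L2_norm (two_scale R L) \<le> 2 * M * (2 * R * sqrt (2 * L))"
      using L2_norm_two_scale_le[OF radii] \<open>0 \<le> M\<close> by (intro mult_left_mono) auto
    finally have "2 * BO_flux (two_scale R L) (\<lambda>x. u x s) \<le> 8 * M * sqrt 2 * (R * sqrt L / T)"
      using \<open>0 < T\<close> by (simp add: field_simps real_sqrt_mult)
    then have "exp (- 4 / 3) * mass_within (R / 2) (\<lambda>x. u x s)
        \<le> 8 * M * sqrt 2 * (R * sqrt L / T) + M\<^sup>2 * (R / L) + 4 * M * N * (1 / sqrt R)"
      using BO_flux_two_scale_ge[OF BO_solution_L2[OF sol] norm_le_M radii, of s]
      unfolding N_def by linarith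
    also have "\<dots> \<le> P * (R * sqrt L / T) + P * (R / L) + P * (1 / sqrt R)"
      using coefficients_le radii \<open>0 < T\<close> by (intro add_mono mult_right_mono) auto
    finally have "mass_within (R / 2) (\<lambda>x. u x s)
        \<le> P / exp (- 4 / 3) * (R * sqrt L / T + R / L + 1 / sqrt R)"
      by (simp add: field_simps)
    then show "\<exists>s\<in>{T..2 * T}. mass_within (R / 2) (\<lambda>x. u x s)
        \<le> P / exp (- 4 / 3) * (R * sqrt L / T + R / L + 1 / sqrt R)"
      using s_between by (intro bexI[of _ s]) auto
  qed
qed

lemma two_scale_error_tendsto_0:
  fixes a b :: real
  assumes "0 < b" "b < 2 / 3" "0 < a"
  defines "R \<equiv> \<lambda>T. 2 * (2 * T) powr b" and "L \<equiv> \<lambda>T. T powr (1 - b / 2)"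
  shows "((\<lambda>T. (R T * sqrt (L T) / T + R T / L T + 1 / sqrt (R T)) * ln (2 * T) powr a) \<longlongrightarrow> 0) at_top"
proof -
  have "((\<lambda>T. (R T * sqrt (L T) / T) * ln (2 * T) powr a) \<longlongrightarrow> 0) at_top"
    unfolding R_def L_def using assms by (real_asymp simp: field_simps)
  moreover have "((\<lambda>T. (R T / L T) * ln (2 * T) powr a) \<longlongrightarrow> 0) at_top"
    unfolding R_def L_def using assms by real_asymp
  moreover have "((\<lambda>T. (1 / sqrt (R T)) * ln (2 * T) powr a) \<longlongrightarrow> 0) at_top"
    unfolding R_def using assms by real_asymp
  ultimately have "((\<lambda>T. (R T * sqrt (L T) / T) * ln (2 * T) powr a + (R T / L T) * ln (2 * T) powr a
      + (1 / sqrt (R T)) * ln (2 * T) powr a) \<longlongrightarrow> 0 + 0 + 0) at_top"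
    by (intro tendsto_add)
  then show ?thesis by (simp add: distrib_right)
qed

lemma frequently_mass_within_le:
  assumes sol: "BO_solution u0 u" and b_bounds: "0 < b" "b < 2 / 3" and "0 < a"
  shows "\<exists>\<^sub>F t in at_top. mass_within (t powr b) (\<lambda>x. u x t) \<le> 1 / ln t powr a"
proof (rule frequently_at_topI)
  obtain A where mass_le: "\<And>T R L. 0 < T \<Longrightarrow> 0 < R \<Longrightarrow> R \<le> L \<Longrightarrow>
      \<exists>s\<in>{T..2 * T}. mass_within (R / 2) (\<lambda>x. u x s) \<le> A * (R * sqrt L / T + R / L + 1 / sqrt R)"
    using mass_within_small_at_some_time[OF sol] by blast
  define R L where "R T = 2 * (2 * T) powr b" and "L T = T powr (1 - b / 2)" for T :: real
  define E where "E T = R T * sqrt (L T) / T + R T / L T + 1 / sqrt (R T)" for T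
  have "((\<lambda>T. A * (E T * ln (2 * T) powr a)) \<longlongrightarrow> A * 0) at_top"
    unfolding E_def R_def L_def by (intro tendsto_mult_left two_scale_error_tendsto_0 assms)
  then have "\<forall>\<^sub>F T in at_top. A * (E T * ln (2 * T) powr a) < 1"
    by (rule order_tendstoD(2)) simp
  moreover have "\<forall>\<^sub>F T in at_top. R T \<le> L T"
    unfolding R_def L_def using b_bounds by real_asymp
  moreover have "\<forall>\<^sub>F T in at_top. (1::real) < T" by (rule eventually_gt_at_top)
  ultimately show "\<forall>\<^sub>F T in at_top. \<exists>s\<ge>T. mass_within (s powr b) (\<lambda>x. u x s) \<le> 1 / ln s powr a"
  proof eventually_elim
    case (elim T)
    then obtain s where s_between: "T \<le> s" "s \<le> 2 * T"
      and mass_s: "mass_within (R T / 2) (\<lambda>x. u x s) \<le> A * E T"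
      using mass_le[of T "R T" "L T"] unfolding E_def R_def by auto
    have "s powr b \<le> R T / 2"
      unfolding R_def using s_between elim(3) b_bounds by (simp add: powr_mono2)
    then have "mass_within (s powr b) (\<lambda>x. u x s) \<le> mass_within (R T / 2) (\<lambda>x. u x s)"
      by (rule mass_within_mono[OF BO_solution_L2[OF sol]])
    also note mass_s
    also have "A * E T \<le> 1 / ln (2 * T) powr a"
      using elim by (simp add: field_simps)
    also have "\<dots> \<le> 1 / ln s powr a"
      using s_between elim(3) \<open>0 < a\<close> by (intro divide_left_mono powr_mono2 mult_pos_pos) auto
    finally show ?case using s_between by blast
  qed
qed

theorem theorem1p1:
  fixes u0 :: "real \<Rightarrow> real" and u :: "real \<Rightarrow> real \<Rightarrow> real" and b :: real
  assumes "L2 u0"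
    and "BO_solution u0 u"
    and "0 < b" and "b < 2 / 3"
  shows "Liminf at_top (\<lambda>t. ereal (LINT x:{x. \<bar>x\<bar> < t powr b}|lborel. (u x t)\<^sup>2)) = 0
     \<and> (\<exists>C > 0. \<exists>tn :: nat \<Rightarrow> real. strict_mono tn \<and> filterlim tn at_top sequentially
           \<and> (\<forall>n. 1 < tn n \<and>
                (LINT x:{x. \<bar>x\<bar> < tn n powr b}|lborel. (u x (tn n))\<^sup>2)
                  \<le> C / (ln (tn n)) powr ((1 - b) / b)))"
  unfolding mass_within_def[symmetric]
proof
  define a where "a = (1 - b) / b"
  let ?m = "\<lambda>t. mass_within (t powr b) (\<lambda>x. u x t)"
  have a_pos: "0 < a" using assms(3,4) by (simp add: a_def)
  have frequently_le: "\<exists>\<^sub>F t in at_top. ?m t \<le> 1 / ln t powr a"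
    by (rule frequently_mass_within_le[OF assms(2-4) a_pos])
  have "((\<lambda>t. 1 / ln t powr a) \<longlongrightarrow> 0) at_top" using a_pos by real_asymp
  with mass_within_nonneg frequently_le show "Liminf at_top (\<lambda>t. ereal (?m t)) = 0"
    by (rule Liminf_eq_0_if_frequently_le)
  have "\<exists>\<^sub>F t in at_top. 1 < t \<and> ?m t \<le> 1 / ln t powr a"
    using frequently_eventually_conj[OF frequently_le eventually_gt_at_top] .
  then obtain \<tau> where "strict_mono \<tau>" "filterlim \<tau> at_top sequentially"
    "\<And>n. 1 < \<tau> n \<and> ?m (\<tau> n) \<le> 1 / ln (\<tau> n) powr a"
    by (rule frequently_at_top_imp_sequence) blast
  then show "\<exists>C>0. \<exists>tn :: nat \<Rightarrow> real. strict_mono tn \<and> filterlim tn at_top sequentially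
      \<and> (\<forall>n. 1 < tn n \<and> ?m (tn n) \<le> C / ln (tn n) powr ((1 - b) / b))"
    unfolding a_def by (intro exI[of _ 1] exI[of _ \<tau>]) auto
qed

end
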